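(* Let $G$ be an abelian group. For any locally compact Hausdorff space $\mathfrak{X}$, the homology $H_*\bigl(G[\mathrm{CSing}(\mathrm{MaxCtl}(\mathfrak{X}))]\bigr)$ is the (locally finitely supported) Borel–Moore singular homology of $\mathfrak{X}$ with coefficients in $G$.
   Context: A controlled set is a set $X$ equipped with a family $\mathcal{U}(X)$ of subsets of $X$ (the controlled subsets) that contains every finite subset of $X$ and is closed under taking subsets and under binary unions. A map $f\colon Y\to X$ of controlled sets is controlled if for every $L\in\mathcal{U}(Y)$ one has $f(L)\in\mathcal{U}(X)$, and $f^{-1}(\{x\})\cap L$ is finite for every $x\in X$. A simplicial controlled set is a simplicial object in the category of controlled sets and controlled maps. For a controlled set $X$, $G[X]$ is the abelian group of formal sums $\sum_{x\in X}[x]g_x$ with $g_x\in G$ such that the support $\{x\in X: g_x\neq 0\}$ lies in $\mathcal{U}(X)$. It is a covariant functor: for a controlled map $f\colon Y\to X$, $f_*(\sum_y [y]g_y)=\sum_y [f(y)]g_y$, adding coefficients where necessary. Applying $G[-]$ to a simplicial controlled set $X$ in each degree gives a simplicial abelian group $G[X]$, and $H_*(G[X])$ denotes the homology of the associated chain complex (with boundary the alternating sum of face maps). For $\mathfrak{X}$ locally compact Hausdorff, $\mathrm{CSing}(\mathrm{MaxCtl}(\mathfrak{X}))$ is the simplicial controlled set whose underlying simplicial set is the singular simplicial set $\mathrm{Sing}(\mathfrak{X})$ and in which a subset $S\subseteq\mathrm{Sing}(\mathfrak{X})_n$ is controlled if and only if each point of $\mathfrak{X}$ has a neighbourhood which meets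 the images of only finitely many simplices in $S$. The locally finitely supported Borel–Moore singular homology of $\mathfrak{X}$ is the homology of locally finite (possibly infinite) singular chains in $\mathfrak{X}$. *)

theory Defs
  imports "HOL-Analysis.Analysis" "HOL-Homology.Homology"
begin

section \<open>Controlled sets\<close>

record 'x ctl_set =
  points :: "'x set"
  controlled :: "'x set set"

definition controlled_set :: "'x ctl_set \<Rightarrow> bool" where
  "controlled_set X \<longleftrightarrow>
     controlled X \<subseteq> Pow (points X) \<and>
     (\<forall>F. finite F \<and> F \<subseteq> points X \<longrightarrow> F \<in> controlled X) \<and>
     (\<forall>L\<in>controlled X. \<forall>K. K \<subseteq> L \<longrightarrow> K \<in> controlled X) \<and>
     (\<forall>L\<in>controlled X. \<forall>K\<in>controlled X. L \<union> K \<in> controlled X)"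

definition controlled_map :: "'y ctl_set \<Rightarrow> 'x ctl_set \<Rightarrow> ('y \<Rightarrow> 'x) \<Rightarrow> bool" where
  "controlled_map Y X f \<longleftrightarrow>
     f ` points Y \<subseteq> points X \<and>
     (\<forall>L\<in>controlled Y. f ` L \<in> controlled X \<and> (\<forall>x\<in>points X. finite (f -` {x} \<inter> L)))"


section \<open>Simplicial controlled sets\<close>

text \<open>
  \<open>ordinal_maps m n\<close> is the set of morphisms \<open>[m] \<rightarrow> [n]\<close> of the simplex category, where
  \<open>[n] = {0, \<dots>, n}\<close>; they are extensional, so that each morphism is one function.
\<close>

definition ordinal_maps :: "nat \<Rightarrow> nat \<Rightarrow> (nat \<Rightarrow> nat) set" where
  "ordinal_maps m n = {\<theta> \<in> {..m} \<rightarrow>\<^sub>E {..n}. mono_on {..m} \<theta>}"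

text \<open>The injection \<open>[n] \<rightarrow> [n + 1]\<close> that omits the value \<open>i\<close>.\<close>

definition coface :: "nat \<Rightarrow> nat \<Rightarrow> nat \<Rightarrow> nat" where
  "coface n i = (\<lambda>j\<in>{..n}. if j < i then j else Suc j)"

text \<open>
  A simplicial object is a contravariant functor on the simplex category: \<open>\<theta> : [m] \<rightarrow> [n]\<close>
  acts by \<open>struct_map X m n \<theta> : level X n \<rightarrow> level X m\<close>. The levels share one ambient type but
  need not be disjoint in it.
\<close>

record 'x simp_ctl_set =
  level :: "nat \<Rightarrow> 'x ctl_set"
  struct_map :: "nat \<Rightarrow> nat \<Rightarrow> (nat \<Rightarrow> nat) \<Rightarrow> 'x \<Rightarrow> 'x"

definition simplicial_controlled_set :: "'x simp_ctl_set \<Rightarrow> bool" where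
  "simplicial_controlled_set X \<longleftrightarrow>
     (\<forall>n. controlled_set (level X n)) \<and>
     (\<forall>m n. \<forall>\<theta>\<in>ordinal_maps m n. controlled_map (level X n) (level X m) (struct_map X m n \<theta>)) \<and>
     (\<forall>n. \<forall>x\<in>points (level X n). struct_map X n n (\<lambda>i\<in>{..n}. i) x = x) \<and>
     (\<forall>k m n. \<forall>\<phi>\<in>ordinal_maps k m. \<forall>\<theta>\<in>ordinal_maps m n. \<forall>x\<in>points (level X n).
        struct_map X k n (compose {..k} \<theta> \<phi>) x = struct_map X k m \<phi> (struct_map X m n \<theta> x))"

definition face_map :: "'x simp_ctl_set \<Rightarrow> nat \<Rightarrow> nat \<Rightarrow> 'x \<Rightarrow> 'x" where
  "face_map X n i = struct_map X n (Suc n) (coface n i)"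


section \<open>Formal sums with controlled support\<close>

definition support :: "('g, 'm) monoid_scheme \<Rightarrow> 'x set \<Rightarrow> ('x \<Rightarrow> 'g) \<Rightarrow> 'x set" where
  "support G S c = {x \<in> S. c x \<noteq> \<one>\<^bsub>G\<^esub>}"

text \<open>
  The group \<open>G[X]\<close>. The coefficient group \<open>G\<close> is written multiplicatively, as always in
  HOL-Algebra, so that \<open>\<one>\<close> is its zero. The formal sum of the \<open>[x] g\<^sub>x\<close> is the (extensional)
  function \<open>x \<mapsto> g\<^sub>x\<close>.
\<close>

definition formal_sums :: "('g, 'm) monoid_scheme \<Rightarrow> 'x ctl_set \<Rightarrow> ('x \<Rightarrow> 'g) monoid" where
  "formal_sums G X = (product_group (points X) (\<lambda>_. G))
     \<lparr>carrier := {c \<in> points X \<rightarrow>\<^sub>E carrier G. support G (points X) c \<in> controlled X}\<rparr>"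

text \<open>
  The homomorphism \<open>f\<^sub>* : G[Y] \<rightarrow> G[X]\<close> for a controlled map \<open>f\<close>. The index set of the product
  is finite, because the support of \<open>c\<close> is controlled.
\<close>

definition push_forward ::
    "('g, 'm) monoid_scheme \<Rightarrow> 'y ctl_set \<Rightarrow> 'x ctl_set \<Rightarrow> ('y \<Rightarrow> 'x) \<Rightarrow> ('y \<Rightarrow> 'g) \<Rightarrow> ('x \<Rightarrow> 'g)" where
  "push_forward G Y X f c =
     (\<lambda>x\<in>points X. finprod G c (f -` {x} \<inter> support G (points Y) c))"

text \<open>
  The differential from degree \<open>n + 1\<close> to degree \<open>n\<close> of the chain complex of \<open>G[X]\<close>, that is,
  the alternating sum of the face maps in degree \<open>n + 1\<close>.
\<close>

definition simp_boundary ::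
    "('g, 'm) monoid_scheme \<Rightarrow> 'x simp_ctl_set \<Rightarrow> nat \<Rightarrow> ('x \<Rightarrow> 'g) \<Rightarrow> ('x \<Rightarrow> 'g)" where
  "simp_boundary G X n c =
     finprod (formal_sums G (level X n))
       (\<lambda>i. push_forward G (level X (Suc n)) (level X n) (face_map X n i) c
              [^]\<^bsub>formal_sums G (level X n)\<^esub> ((-1) ^ i :: int))
       {..Suc n}"


section \<open>Homology of a non-negatively graded chain complex\<close>

text \<open>Here \<open>d n\<close> is the differential from \<open>C (n + 1)\<close> to \<open>C n\<close>.\<close>

definition cycles :: "(nat \<Rightarrow> 'c monoid) \<Rightarrow> (nat \<Rightarrow> 'c \<Rightarrow> 'c) \<Rightarrow> nat \<Rightarrow> 'c set" where
  "cycles C d n = (case n of 0 \<Rightarrow> carrier (C 0) | Suc k \<Rightarrow> kernel (C (Suc k)) (C k) (d k))"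

definition boundaries :: "(nat \<Rightarrow> 'c monoid) \<Rightarrow> (nat \<Rightarrow> 'c \<Rightarrow> 'c) \<Rightarrow> nat \<Rightarrow> 'c set" where
  "boundaries C d n = d n ` carrier (C (Suc n))"

definition homology :: "(nat \<Rightarrow> 'c monoid) \<Rightarrow> (nat \<Rightarrow> 'c \<Rightarrow> 'c) \<Rightarrow> nat \<Rightarrow> 'c set monoid" where
  "homology C d n = (C n)\<lparr>carrier := cycles C d n\<rparr> Mod boundaries C d n"

definition homology_class :: "(nat \<Rightarrow> 'c monoid) \<Rightarrow> (nat \<Rightarrow> 'c \<Rightarrow> 'c) \<Rightarrow> nat \<Rightarrow> 'c \<Rightarrow> 'c set" where
  "homology_class C d n z = boundaries C d n #>\<^bsub>C n\<^esub> z"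


section \<open>The simplicial controlled set of singular simplices\<close>

definition locally_finite_simplices ::
    "nat \<Rightarrow> 'a topology \<Rightarrow> ((nat \<Rightarrow> real) \<Rightarrow> 'a) set \<Rightarrow> bool" where
  "locally_finite_simplices n X S \<longleftrightarrow>
     (\<forall>x\<in>topspace X. \<exists>U. openin X U \<and> x \<in> U \<and>
        finite {\<sigma> \<in> S. \<sigma> ` standard_simplex n \<inter> U \<noteq> {}})"

text \<open>The affine map of standard simplices which sends the vertex \<open>e\<^sub>i\<close> to \<open>e\<^bsub>\<theta> i\<^esub>\<close>.\<close>

definition simplex_map :: "nat \<Rightarrow> (nat \<Rightarrow> nat) \<Rightarrow> (nat \<Rightarrow> real) \<Rightarrow> (nat \<Rightarrow> real)" where
  "simplex_map m \<theta> t = (\<lambda>j. \<Sum>i | i \<le> m \<and> \<theta> i = j. t i)"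

text \<open>
  \<open>CSing_MaxCtl X\<close> is \<open>CSing(MaxCtl(X))\<close>. Singular simplices are extensional on the standard
  simplex, whence the restriction in the structure maps.
\<close>

definition CSing_MaxCtl :: "'a topology \<Rightarrow> ((nat \<Rightarrow> real) \<Rightarrow> 'a) simp_ctl_set" where
  "CSing_MaxCtl X =
     \<lparr>level = (\<lambda>n. \<lparr>points = singular_simplex_set n X,
                    controlled = {S. S \<subseteq> singular_simplex_set n X \<and> locally_finite_simplices n X S}\<rparr>),
      struct_map = (\<lambda>m n \<theta> \<sigma>. restrict (\<sigma> \<circ> simplex_map m \<theta>) (standard_simplex m))\<rparr>"

lemma simplex_map_in_standard_simplex:
  assumes \<theta>: "\<theta> \<in> {..m} \<rightarrow> {..n}" and t: "t \<in> standard_simplex m"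
  shows "simplex_map m \<theta> t \<in> standard_simplex n"
proof -
  have t0: "0 \<le> t i" for i
    using t by (auto simp: standard_simplex_def)
  have t1: "(\<Sum>i\<le>m. t i) = 1"
    using t by (auto simp: standard_simplex_def)
  have ge0: "0 \<le> simplex_map m \<theta> t j" for j
    unfolding simplex_map_def by (simp add: sum_nonneg t0)
  have le1: "simplex_map m \<theta> t j \<le> 1" for j
    unfolding simplex_map_def t1[symmetric] by (rule sum_mono2) (auto simp: t0)
  have zero: "simplex_map m \<theta> t j = 0" if "j > n" for j
  proof -
    have "\<theta> i \<le> n" if "i \<le> m" for i
      using \<theta> that by auto
    then have "{i. i \<le> m \<and> \<theta> i = j} = {}"
      using that by force
    then show ?thesis
      by (simp only: simplex_map_def sum.empty)
  qed
  have "(\<Sum>j\<le>n. simplex_map m \<theta> t j) = (\<Sum>j\<in>{..n}. \<Sum>i | i \<in> {..m} \<and> \<theta> i = j. t i)"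
    by (simp add: simplex_map_def)
  also have "\<dots> = (\<Sum>i\<le>m. t i)"
    by (rule sum.group) (use \<theta> in auto)
  finally show ?thesis
    using ge0 le1 zero t1 by (auto simp: standard_simplex_def)
qed

lemma continuous_map_simplex_map:
  assumes "\<theta> \<in> {..m} \<rightarrow> {..n}"
  shows "continuous_map (subtopology (powertop_real UNIV) (standard_simplex m))
           (subtopology (powertop_real UNIV) (standard_simplex n)) (simplex_map m \<theta>)"
proof -
  have "continuous_map (powertop_real UNIV) euclideanreal (\<lambda>t. simplex_map m \<theta> t j)" for j
    unfolding simplex_map_def
    by (intro continuous_map_sum continuous_map_product_projection) auto
  then have "continuous_map (powertop_real UNIV) (powertop_real UNIV) (simplex_map m \<theta>)"
    by (simp add: continuous_map_componentwise_UNIV)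
  then show ?thesis
    using assms simplex_map_in_standard_simplex
    by (auto simp: continuous_map_in_subtopology continuous_map_from_subtopology)
qed

lemma simplex_map_id:
  assumes "t \<in> standard_simplex n"
  shows "simplex_map n (\<lambda>i\<in>{..n}. i) t = t"
proof
  fix j
  have "{i. i \<le> n \<and> (\<lambda>i\<in>{..n}. i) i = j} = (if j \<le> n then {j} else {})"
    by auto
  then have "simplex_map n (\<lambda>i\<in>{..n}. i) t j = (if j \<le> n then t j else 0)"
    by (simp only: simplex_map_def) simp
  then show "simplex_map n (\<lambda>i\<in>{..n}. i) t j = t j"
    using assms by (auto simp: standard_simplex_def)
qed

lemma simplex_map_compose:
  assumes "\<phi> \<in> {..k} \<rightarrow> {..m}"
  shows "simplex_map k (compose {..k} \<theta> \<phi>) t = simplex_map m \<theta> (simplex_map k \<phi> t)"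
proof
  fix j
  have "simplex_map m \<theta> (simplex_map k \<phi> t) j =
        (\<Sum>l\<in>{l. l \<le> m \<and> \<theta> l = j}. \<Sum>i | i \<in> {i. i \<le> k \<and> \<theta> (\<phi> i) = j} \<and> \<phi> i = l. t i)"
    unfolding simplex_map_def by (intro sum.cong) auto
  also have "\<dots> = (\<Sum>i\<in>{i. i \<le> k \<and> \<theta> (\<phi> i) = j}. t i)"
    by (rule sum.group) (use assms in auto)
  also have "\<dots> = simplex_map k (compose {..k} \<theta> \<phi>) t j"
    unfolding simplex_map_def by (intro sum.cong) (auto simp: compose_def)
  finally show "simplex_map k (compose {..k} \<theta> \<phi>) t j = simplex_map m \<theta> (simplex_map k \<phi> t) j"
    by simp
qed

lemma locally_finite_simplicesE:
  assumes "locally_finite_simplices n X S" "x \<in> topspace X"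
  obtains U where "openin X U" "x \<in> U" "finite {\<sigma> \<in> S. \<sigma> ` standard_simplex n \<inter> U \<noteq> {}}"
  using bspec[OF assms(1)[unfolded locally_finite_simplices_def] assms(2)] that by (elim exE conjE)

lemma locally_finite_simplicesI:
  assumes "\<And>x. x \<in> topspace X \<Longrightarrow>
    \<exists>U. openin X U \<and> x \<in> U \<and> finite {\<sigma> \<in> S. \<sigma> ` standard_simplex n \<inter> U \<noteq> {}}"
  shows "locally_finite_simplices n X S"
  unfolding locally_finite_simplices_def by (rule ballI) (rule assms)

lemma locally_finite_simplices_image:
  assumes "locally_finite_simplices n X S"
    and f: "\<And>\<sigma>. \<sigma> \<in> S \<Longrightarrow> f \<sigma> ` standard_simplex m \<subseteq> \<sigma> ` standard_simplex n"
    and K: "K \<subseteq> f ` S"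
  shows "locally_finite_simplices m X K"
proof (rule locally_finite_simplicesI)
  fix x assume "x \<in> topspace X"
  with assms(1) obtain U
    where U: "openin X U" "x \<in> U" "finite {\<sigma> \<in> S. \<sigma> ` standard_simplex n \<inter> U \<noteq> {}}"
    by (rule locally_finite_simplicesE)
  have "{\<tau> \<in> K. \<tau> ` standard_simplex m \<inter> U \<noteq> {}}
        \<subseteq> f ` {\<sigma> \<in> S. \<sigma> ` standard_simplex n \<inter> U \<noteq> {}}"
  proof
    fix \<tau> assume \<tau>: "\<tau> \<in> {\<tau> \<in> K. \<tau> ` standard_simplex m \<inter> U \<noteq> {}}"
    then obtain \<sigma> where \<sigma>: "\<sigma> \<in> S" "\<tau> = f \<sigma>"
      using K by auto
    with \<tau> f[OF \<sigma>(1)] have "\<sigma> ` standard_simplex n \<inter> U \<noteq> {}"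
      by blast
    with \<sigma> show "\<tau> \<in> f ` {\<sigma> \<in> S. \<sigma> ` standard_simplex n \<inter> U \<noteq> {}}"
      by simp
  qed
  then have "finite {\<tau> \<in> K. \<tau> ` standard_simplex m \<inter> U \<noteq> {}}"
    using U(3) by (meson finite_imageI finite_subset)
  with U(1,2) show "\<exists>U. openin X U \<and> x \<in> U \<and> finite {\<tau> \<in> K. \<tau> ` standard_simplex m \<inter> U \<noteq> {}}"
    by (intro exI conjI)
qed

lemma locally_finite_simplices_Un:
  assumes "locally_finite_simplices n X L" "locally_finite_simplices n X K"
  shows "locally_finite_simplices n X (L \<union> K)"
proof (rule locally_finite_simplicesI)
  fix x assume x: "x \<in> topspace X"
  from assms(1) x obtain U
    where U: "openin X U" "x \<in> U" "finite {\<sigma> \<in> L. \<sigma> ` standard_simplex n \<inter> U \<noteq> {}}"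
    by (rule locally_finite_simplicesE)
  from assms(2) x obtain V
    where V: "openin X V" "x \<in> V" "finite {\<sigma> \<in> K. \<sigma> ` standard_simplex n \<inter> V \<noteq> {}}"
    by (rule locally_finite_simplicesE)
  have "{\<sigma> \<in> L \<union> K. \<sigma> ` standard_simplex n \<inter> (U \<inter> V) \<noteq> {}}
        \<subseteq> {\<sigma> \<in> L. \<sigma> ` standard_simplex n \<inter> U \<noteq> {}} \<union> {\<sigma> \<in> K. \<sigma> ` standard_simplex n \<inter> V \<noteq> {}}"
    by blast
  then have "finite {\<sigma> \<in> L \<union> K. \<sigma> ` standard_simplex n \<inter> (U \<inter> V) \<noteq> {}}"
    using U(3) V(3) by (meson finite_UnI finite_subset)
  with U V show "\<exists>U. openin X U \<and> x \<in> U \<and> finite {\<sigma> \<in> L \<union> K. \<sigma> ` standard_simplex n \<inter> U \<noteq> {}}"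
    by (intro exI[of _ "U \<inter> V"] conjI) auto
qed

lemma simplicial_controlled_set_CSing_MaxCtl: "simplicial_controlled_set (CSing_MaxCtl X)"
proof -
  have "controlled_set (level (CSing_MaxCtl X) n)" for n
  proof -
    have fin: "locally_finite_simplices n X F" if "finite F" for F
      using that by (intro locally_finite_simplicesI exI[of _ "topspace X"]) auto
    have sub: "locally_finite_simplices n X K" if "locally_finite_simplices n X L" "K \<subseteq> L" for K L
      using that(1) by (rule locally_finite_simplices_image[where f = "\<lambda>\<sigma>. \<sigma>"]) (use that(2) in auto)
    show ?thesis
      unfolding controlled_set_def CSing_MaxCtl_def
      using fin sub locally_finite_simplices_Un[of n X] by auto
  qed
  moreover have "controlled_map (level (CSing_MaxCtl X) n) (level (CSing_MaxCtl X) m)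
                   (struct_map (CSing_MaxCtl X) m n \<theta>)"
    if "\<theta> \<in> ordinal_maps m n" for m n \<theta>
  proof -
    have \<theta>: "\<theta> \<in> {..m} \<rightarrow> {..n}"
      using that by (auto simp: ordinal_maps_def)
    let ?f = "\<lambda>\<sigma>. restrict (\<sigma> \<circ> simplex_map m \<theta>) (standard_simplex m)"
    have sing: "singular_simplex m X (?f \<sigma>)" if "singular_simplex n X \<sigma>" for \<sigma>
    proof -
      have "continuous_map (subtopology (powertop_real UNIV) (standard_simplex m)) X (\<sigma> \<circ> simplex_map m \<theta>)"
        using that continuous_map_compose[OF continuous_map_simplex_map[OF \<theta>]]
        by (auto simp: singular_simplex_def)
      then have "continuous_map (subtopology (powertop_real UNIV) (standard_simplex m)) X (?f \<sigma>)"
        by (rule continuous_map_eq) auto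
      then show ?thesis
        by (simp add: singular_simplex_def)
    qed
    have img: "?f \<sigma> ` standard_simplex m \<subseteq> \<sigma> ` standard_simplex n" for \<sigma> :: "(nat \<Rightarrow> real) \<Rightarrow> 'a"
      using simplex_map_in_standard_simplex[OF \<theta>] by auto
    have lf: "locally_finite_simplices m X (?f ` L)" if "locally_finite_simplices n X L" for L
      using that img by (rule locally_finite_simplices_image) auto
    have fin: "finite (?f -` {\<tau>} \<inter> L)"
      if L: "locally_finite_simplices n X L" and \<tau>: "singular_simplex m X \<tau>" for L \<tau>
    proof -
      obtain t where t: "t \<in> standard_simplex m"
        using nonempty_standard_simplex by blast
      have "\<tau> t \<in> topspace X"
        using \<tau> t by (auto simp: singular_simplex_def continuous_map_def)
      with L obtain U where U: "openin X U" "\<tau> t \<in> U" "finite {\<sigma> \<in> L. \<sigma> ` standard_simplex n \<inter> U \<noteq> {}}"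
        by (rule locally_finite_simplicesE)
      have "?f -` {\<tau>} \<inter> L \<subseteq> {\<sigma> \<in> L. \<sigma> ` standard_simplex n \<inter> U \<noteq> {}}"
      proof
        fix \<sigma> assume \<sigma>: "\<sigma> \<in> ?f -` {\<tau>} \<inter> L"
        then have "\<tau> ` standard_simplex m \<subseteq> \<sigma> ` standard_simplex n"
          using img[of \<sigma>] by simp
        with \<sigma> t U(2) show "\<sigma> \<in> {\<sigma> \<in> L. \<sigma> ` standard_simplex n \<inter> U \<noteq> {}}"
          by auto
      qed
      then show ?thesis
        using U(3) by (rule finite_subset)
    qed
    show ?thesis
      unfolding controlled_map_def CSing_MaxCtl_def using sing lf fin by auto
  qed
  moreover have "struct_map (CSing_MaxCtl X) n n (\<lambda>i\<in>{..n}. i) \<sigma> = \<sigma>"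
    if "\<sigma> \<in> points (level (CSing_MaxCtl X) n)" for n \<sigma>
  proof -
    have "\<sigma> \<in> extensional (standard_simplex n)"
      using that by (simp add: CSing_MaxCtl_def singular_simplex_def)
    then have "restrict (\<sigma> \<circ> simplex_map n (\<lambda>i\<in>{..n}. i)) (standard_simplex n) = \<sigma>"
      by (intro extensionalityI[of _ "standard_simplex n"]) (simp_all only: restrict_extensional restrict_apply' o_apply simplex_map_id)
    then show ?thesis
      by (simp only: CSing_MaxCtl_def simp_ctl_set.simps)
  qed
  moreover have "struct_map (CSing_MaxCtl X) k n (compose {..k} \<theta> \<phi>) \<sigma> =
                 struct_map (CSing_MaxCtl X) k m \<phi> (struct_map (CSing_MaxCtl X) m n \<theta> \<sigma>)"
    if "\<phi> \<in> ordinal_maps k m" for k m n \<theta> \<phi> \<sigma>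
  proof -
    have \<phi>: "\<phi> \<in> {..k} \<rightarrow> {..m}"
      using that by (auto simp: ordinal_maps_def)
    show ?thesis
      using simplex_map_in_standard_simplex[OF \<phi>]
      by (auto simp: CSing_MaxCtl_def restrict_def simplex_map_compose[OF \<phi>])
  qed
  ultimately show ?thesis
    unfolding simplicial_controlled_set_def by blast
qed


section \<open>Borel--Moore singular chains\<close>

text \<open>
  A locally finite chain, the formal sum of the \<open>g\<^sub>\<sigma> \<sigma>\<close>, is the (extensional) function
  \<open>\<sigma> \<mapsto> g\<^sub>\<sigma>\<close>.
\<close>

definition BM_chain_group ::
    "('g, 'm) monoid_scheme \<Rightarrow> 'a topology \<Rightarrow> nat \<Rightarrow> (((nat \<Rightarrow> real) \<Rightarrow> 'a) \<Rightarrow> 'g) monoid" where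
  "BM_chain_group G X n = (product_group (singular_simplex_set n X) (\<lambda>_. G))
     \<lparr>carrier := {c \<in> singular_simplex_set n X \<rightarrow>\<^sub>E carrier G.
                   locally_finite_simplices n X (support G (singular_simplex_set n X) c)}\<rparr>"

text \<open>
  The coefficient at \<open>\<tau>\<close> of the boundary, from degree \<open>n + 1\<close> to degree \<open>n\<close>: the sum of
  \<open>(-1)\<^sup>k c \<sigma>\<close> over the finitely many pairs \<open>(\<sigma>, k)\<close> with \<open>c \<sigma>\<close> nonzero for which \<open>\<tau>\<close> is the
  \<open>k\<close>-th face of \<open>\<sigma>\<close>.
\<close>

definition BM_boundary ::
    "('g, 'm) monoid_scheme \<Rightarrow> 'a topology \<Rightarrow> nat \<Rightarrow>
     (((nat \<Rightarrow> real) \<Rightarrow> 'a) \<Rightarrow> 'g) \<Rightarrow> (((nat \<Rightarrow> real) \<Rightarrow> 'a) \<Rightarrow> 'g)" where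
  "BM_boundary G X n c =
     (\<lambda>\<tau>\<in>singular_simplex_set n X.
        finprod G (\<lambda>(\<sigma>, k). c \<sigma> [^]\<^bsub>G\<^esub> ((-1) ^ k :: int))
          {(\<sigma>, k). \<sigma> \<in> support G (singular_simplex_set (Suc n) X) c \<and> k \<le> Suc n \<and>
                   singular_face (Suc n) k \<sigma> = \<tau>})"

abbreviation BM_homology where
  "BM_homology G X \<equiv> homology (BM_chain_group G X) (BM_boundary G X)"

abbreviation BM_homology_class where
  "BM_homology_class G X \<equiv> homology_class (BM_chain_group G X) (BM_boundary G X)"

abbreviation simp_homology where
  "simp_homology G X \<equiv> homology (\<lambda>n. formal_sums G (level X n)) (simp_boundary G X)"

abbreviation simp_homology_class where
  "simp_homology_class G X \<equiv> homology_class (\<lambda>n. formal_sums G (level X n)) (simp_boundary G X)"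

abbreviation simp_cycles where
  "simp_cycles G X \<equiv> cycles (\<lambda>n. formal_sums G (level X n)) (simp_boundary G X)"

end

theory Submission
  imports Defs
begin

text \<open>
  The two chain complexes coincide. In each degree, a formal sum with controlled support is a locally
  finite singular chain. The coefficient of the alternating sum of faces at \<open>\<tau>\<close> can be computed
  pointwise, because evaluation at \<open>\<tau>\<close> is a homomorphism; exchanging the sum over the faces with
  the sums over their (finite) fibres yields the sum over pairs \<open>(\<sigma>, k)\<close> that defines the
  Borel--Moore boundary. Hence the identity is an isomorphism on homology.
\<close>

text \<open>Induction on the index set. Over an empty or infinite set both products have the default
  value one. Preservation of the unit is a separate assumption because \<open>hom\<close> demands
  only multiplicativity, which does not imply it for monoids.\<close>

lemma finprod_hom:
  assumes G: "comm_monoid G" and H: "comm_monoid H" and h: "h \<in> hom G H" "h \<one>\<^bsub>G\<^esub> = \<one>\<^bsub>H\<^esub>"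
    and f: "f \<in> A \<rightarrow> carrier G"
  shows "h (finprod G f A) = finprod H (\<lambda>i. h (f i)) A"
  using f
proof (induction A rule: infinite_finite_induct)
  case (infinite A)
  with G H h show ?case
    by (simp add: comm_monoid.finprod_infinite)
next
  case empty
  with G H h show ?case
    by (simp add: comm_monoid.finprod_empty)
next
  case (insert a A)
  then have "f a \<in> carrier G" "f \<in> A \<rightarrow> carrier G"
    by auto
  moreover from this have "h (f a) \<in> carrier H" "(\<lambda>i. h (f i)) \<in> A \<rightarrow> carrier H"
    using h(1) by (auto simp: hom_def)
  ultimately show ?case
    using insert G H h(1)
    by (simp add: comm_monoid.finprod_insert comm_monoid.finprod_closed hom_mult)
qed

text \<open>In an abelian group, raising to a fixed integer power is an endomorphism.\<close>

lemma (in comm_group) finprod_int_pow: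
  fixes k :: int
  assumes "f \<in> A \<rightarrow> carrier G"
  shows "finprod G f A [^] k = (\<Otimes>i\<in>A. f i [^] k)"
proof (rule finprod_hom)
  show "(\<lambda>x. x [^] k) \<in> hom G G"
    by (rule homI) (simp_all add: int_pow_distrib)
qed (use assms comm_monoid_axioms in auto)

text \<open>\<open>Sigma A B\<close> is the disjoint union of copies of the finite sets
  \<open>B i\<close>, each embedded by \<open>Pair i\<close>.\<close>

lemma (in comm_monoid) finprod_Sigma:
  assumes "finite A" "\<And>i. i \<in> A \<Longrightarrow> finite (B i)"
    and f: "\<And>i j. i \<in> A \<Longrightarrow> j \<in> B i \<Longrightarrow> f i j \<in> carrier G"
  shows "(\<Otimes>i\<in>A. \<Otimes>j\<in>B i. f i j) = finprod G (\<lambda>(i, j). f i j) (Sigma A B)"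
proof -
  have "finprod G (\<lambda>(i, j). f i j) (Sigma A B) = (\<Otimes>p\<in>(\<Union>i\<in>A. Pair i ` B i). case p of (i, j) \<Rightarrow> f i j)"
    by (rule arg_cong[where f = "finprod G _"]) auto
  also have "\<dots> = (\<Otimes>i\<in>A. \<Otimes>p\<in>Pair i ` B i. case p of (i, j) \<Rightarrow> f i j)"
    by (rule finprod_UN_disjoint) (use assms in \<open>auto simp: pairwise_def disjnt_def\<close>)
  also have "\<dots> = (\<Otimes>i\<in>A. \<Otimes>j\<in>B i. f i j)"
  proof (rule finprod_cong')
    fix i assume i: "i \<in> A"
    show "(\<Otimes>p\<in>Pair i ` B i. case p of (i, j) \<Rightarrow> f i j) = (\<Otimes>j\<in>B i. f i j)"
      using f[OF i] by (subst finprod_reindex) (auto simp: inj_on_def)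
  qed (use f in auto)
  finally show ?thesis by simp
qed

lemma carrier_formal_sums:
  "carrier (formal_sums G X) =
     {c \<in> points X \<rightarrow>\<^sub>E carrier G. support G (points X) c \<in> controlled X}"
  by (simp add: formal_sums_def)

text \<open>The controlled sets form an ideal of subsets: inversion does not enlarge a support, and
  a product is supported in the union of two supports. The group axioms for formal sums are then
  inherited from the full product.\<close>

lemma formal_sums_subgroup:
  fixes G (structure)
  assumes G: "group G" and X: "controlled_set X"
  shows "subgroup (carrier (formal_sums G X)) (product_group (points X) (\<lambda>_. G))"
proof -
  interpret group G by fact
  have sub: "K \<in> controlled X" if "L \<in> controlled X" "K \<subseteq> L" for K L
    using X that unfolding controlled_set_def by blast
  have un: "L \<union> K \<in> controlled X" if "L \<in> controlled X" "K \<in> controlled X" for K L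
    using X that unfolding controlled_set_def by blast
  have empty: "{} \<in> controlled X"
    using X unfolding controlled_set_def by blast
  show ?thesis
  proof (rule group.subgroupI)
    show "group (product_group (points X) (\<lambda>_. G))"
      by (simp add: is_group)
    have "(\<lambda>x\<in>points X. \<one>) \<in> carrier (formal_sums G X)"
      by (auto simp: carrier_formal_sums support_def intro: sub[OF empty])
    then show "carrier (formal_sums G X) \<noteq> {}"
      by blast
    fix a assume a: "a \<in> carrier (formal_sums G X)"
    then have "inv\<^bsub>product_group (points X) (\<lambda>_. G)\<^esub> a = (\<lambda>x\<in>points X. inv a x)"
      by (intro inv_product_group) (auto simp: carrier_formal_sums is_group)
    with a show "inv\<^bsub>product_group (points X) (\<lambda>_. G)\<^esub> a \<in> carrier (formal_sums G X)"
      by (auto simp: carrier_formal_sums support_def intro: sub)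
    fix b assume b: "b \<in> carrier (formal_sums G X)"
    have "support G (points X) (\<lambda>x\<in>points X. a x \<otimes> b x)
          \<subseteq> support G (points X) a \<union> support G (points X) b"
      by (auto simp: support_def)
    with a b show "a \<otimes>\<^bsub>product_group (points X) (\<lambda>_. G)\<^esub> b \<in> carrier (formal_sums G X)"
      by (auto simp: carrier_formal_sums intro: sub[OF un])
  qed (auto simp: carrier_formal_sums)
qed

lemma mult_formal_sums: "a \<otimes>\<^bsub>formal_sums G X\<^esub> b = (\<lambda>x\<in>points X. a x \<otimes>\<^bsub>G\<^esub> b x)"
  by (simp add: formal_sums_def)

lemma one_formal_sums: "\<one>\<^bsub>formal_sums G X\<^esub> = (\<lambda>x\<in>points X. \<one>\<^bsub>G\<^esub>)"
  by (simp add: formal_sums_def)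

lemma formal_sums_comm_group:
  assumes "comm_group G" "controlled_set X"
  shows "comm_group (formal_sums G X)"
proof -
  interpret comm_group G by fact
  have "group (product_group (points X) (\<lambda>_. G))"
    by (simp add: is_group)
  with formal_sums_subgroup[OF is_group assms(2)]
  have "group ((product_group (points X) (\<lambda>_. G))\<lparr>carrier := carrier (formal_sums G X)\<rparr>)"
    by (rule subgroup.subgroup_is_group)
  then have "group (formal_sums G X)"
    by (simp add: formal_sums_def)
  then show ?thesis
    by (rule group.group_comm_groupI)
      (auto simp: mult_formal_sums carrier_formal_sums intro!: restrict_ext m_comm)
qed

lemma formal_sums_eval_hom:
  "x \<in> points X \<Longrightarrow> (\<lambda>c. c x) \<in> hom (formal_sums G X) G"
  by (rule homI) (auto simp: carrier_formal_sums mult_formal_sums)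

text \<open>At a point outside \<open>f\<close> of the support the coefficient is an empty product,
  so the support of the image lies in a controlled set.\<close>

lemma push_forward_closed:
  assumes G: "comm_group G" and X: "controlled_set X" and f: "controlled_map Y X f"
    and c: "c \<in> carrier (formal_sums G Y)"
  shows "push_forward G Y X f c \<in> carrier (formal_sums G X)"
proof -
  interpret comm_group G by fact
  let ?S = "support G (points Y) c"
  have cG: "c y \<in> carrier G" if "y \<in> ?S" for y
    using c that by (auto simp: carrier_formal_sums support_def)
  have "x \<in> f ` ?S" if "x \<in> support G (points X) (push_forward G Y X f c)" for x
  proof (rule ccontr)
    assume "x \<notin> f ` ?S"
    then have "f -` {x} \<inter> ?S = {}"
      by auto
    then have "push_forward G Y X f c x = \<one>\<^bsub>G\<^esub>" if "x \<in> points X"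
      using that by (simp add: push_forward_def)
    with that show False
      by (auto simp: support_def)
  qed
  moreover have "f ` ?S \<in> controlled X"
    using f c by (simp add: controlled_map_def carrier_formal_sums)
  ultimately have "support G (points X) (push_forward G Y X f c) \<in> controlled X"
    using X unfolding controlled_set_def by (meson subsetI)
  moreover have "push_forward G Y X f c \<in> points X \<rightarrow>\<^sub>E carrier G"
    using cG by (auto simp: push_forward_def intro!: finprod_closed)
  ultimately show ?thesis
    by (simp add: carrier_formal_sums)
qed

text \<open>Valid for all \<open>i\<close>: once \<open>i > n\<close>, the coface is the inclusion
  of \<open>{..n}\<close> into \<open>{..Suc n}\<close>. Face maps are therefore controlled without
  a bound on the index.\<close>

lemma coface_ordinal_map: "coface n i \<in> ordinal_maps n (Suc n)"
  by (auto simp: ordinal_maps_def coface_def mono_on_def)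

text \<open>Controlledness of the face maps makes each push-forward a chain and each fibre within
  the support finite. The formula already has the shape of the Borel-Moore boundary, although
  singular simplices enter only later.\<close>

lemma simp_boundary_closed_apply:
  fixes G (structure)
  assumes G: "comm_group G" and X: "simplicial_controlled_set X"
    and c: "c \<in> carrier (formal_sums G (level X (Suc n)))"
  shows "simp_boundary G X n c \<in> carrier (formal_sums G (level X n))" (is ?closed)
    and "x \<in> points (level X n) \<Longrightarrow> simp_boundary G X n c x =
      finprod G (\<lambda>(y, k). c y [^] ((-1) ^ k :: int))
        {(y, k). y \<in> support G (points (level X (Suc n))) c \<and> k \<le> Suc n \<and> face_map X n k y = x}"
proof -
  interpret comm_group G by fact
  have Xn: "controlled_set (level X n)"
    using X by (simp add: simplicial_controlled_set_def)
  have face: "controlled_map (level X (Suc n)) (level X n) (face_map X n k)" for k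
    using X coface_ordinal_map unfolding simplicial_controlled_set_def face_map_def by blast
  interpret F: comm_group "formal_sums G (level X n)"
    by (rule formal_sums_comm_group[OF G Xn])
  let ?S = "support G (points (level X (Suc n))) c"
  let ?p = "\<lambda>k. push_forward G (level X (Suc n)) (level X n) (face_map X n k) c"
  have p: "?p k \<in> carrier (formal_sums G (level X n))" for k
    by (rule push_forward_closed[OF G Xn face c])
  have cG: "c y \<in> carrier G" if "y \<in> ?S" for y
    using c that by (auto simp: carrier_formal_sums support_def)
  show ?closed
    unfolding simp_boundary_def by (rule F.finprod_closed) (use p in auto)
  assume x: "x \<in> points (level X n)"
  let ?F = "\<lambda>k. face_map X n k -` {x} \<inter> ?S"
  let ?D = "{(y, k). y \<in> ?S \<and> k \<le> Suc n \<and> face_map X n k y = x}"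
  have eval: "(\<lambda>a. a x) \<in> hom (formal_sums G (level X n)) G"
    using x by (rule formal_sums_eval_hom)
  \<comment> \<open>The fibre clause of \<open>controlled_map\<close>, applied to the controlled
    support of \<open>c\<close>. It allows the iterated product to be merged into one over
    pairs.\<close>
  have fin: "finite (?F k)" for k
    using face[of k] c x by (simp add: controlled_map_def carrier_formal_sums)
  have "simp_boundary G X n c x =
      (\<Otimes>k\<in>{..Suc n}. (?p k [^]\<^bsub>formal_sums G (level X n)\<^esub> ((-1) ^ k :: int)) x)"
    unfolding simp_boundary_def
    by (rule finprod_hom[OF F.comm_monoid_axioms comm_monoid_axioms eval])
      (use p x in \<open>auto simp: one_formal_sums\<close>)
  also have "\<dots> = (\<Otimes>k\<in>{..Suc n}. \<Otimes>y\<in>?F k. c y [^] ((-1) ^ k :: int))"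
  proof (rule finprod_cong')
    fix k
    have "(?p k [^]\<^bsub>formal_sums G (level X n)\<^esub> ((-1) ^ k :: int)) x = ?p k x [^] ((-1) ^ k :: int)"
      by (rule hom_int_pow[OF eval p F.is_group is_group])
    also have "\<dots> = finprod G c (?F k) [^] ((-1) ^ k :: int)"
      using x by (simp add: push_forward_def)
    also have "\<dots> = (\<Otimes>y\<in>?F k. c y [^] ((-1) ^ k :: int))"
      by (rule finprod_int_pow) (use cG in auto)
    finally show "(?p k [^]\<^bsub>formal_sums G (level X n)\<^esub> ((-1) ^ k :: int)) x =
      (\<Otimes>y\<in>?F k. c y [^] ((-1) ^ k :: int))" .
  qed (use cG in \<open>auto intro!: finprod_closed\<close>)
  also have "\<dots> = finprod G (\<lambda>(k, y). c y [^] ((-1) ^ k :: int)) (Sigma {..Suc n} ?F)"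
    by (rule finprod_Sigma) (use fin cG in auto)
  \<comment> \<open>The iterated product yields pairs with the face index first, whereas
    \<open>?D\<close> has it second. The swap is injective, so it reindexes the product.\<close>
  also have "Sigma {..Suc n} ?F = prod.swap ` ?D"
    by force
  also have "finprod G (\<lambda>(k, y). c y [^] ((-1) ^ k :: int)) (prod.swap ` ?D) =
      (\<Otimes>q\<in>?D. case prod.swap q of (k, y) \<Rightarrow> c y [^] ((-1) ^ k :: int))"
    by (rule finprod_reindex) (use cG in auto)
  also have "\<dots> = finprod G (\<lambda>(y, k). c y [^] ((-1) ^ k :: int)) ?D"
    by (simp add: case_prod_unfold)
  finally show "simp_boundary G X n c x = finprod G (\<lambda>(y, k). c y [^] ((-1) ^ k :: int)) ?D" .
qed

text \<open>The vertex map skips \<open>k\<close>, so the induced affine map inserts a zero at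
  coordinate \<open>k\<close> and shifts the later coordinates up.\<close>

lemma simplex_map_coface:
  assumes t: "t \<in> standard_simplex n"
  shows "simplex_map n (coface n k) t = simplical_face k t"
proof
  fix j
  have "simplex_map n (coface n k) t j =
      (\<Sum>i\<in>{i. i \<le> n \<and> (if i < k then i else Suc i) = j}. t i)"
    unfolding simplex_map_def by (rule sum.cong) (auto simp: coface_def)
  \<comment> \<open>The fibre of the coface over \<open>j\<close>. In the last branch
    \<open>j > k\<close>, so \<open>j - 1\<close> is a genuine predecessor. Cutting down to
    \<open>{..n}\<close> does not change the sum, since the coordinates of \<open>t\<close> beyond
    \<open>n\<close> vanish.\<close>
  also have "{i. i \<le> n \<and> (if i < k then i else Suc i) = j} =
      (if j < k then {j} else if j = k then {} else {j - 1}) \<inter> {..n}"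
    by (auto split: if_splits)
  also have "sum t \<dots> = simplical_face k t j"
    using t by (simp add: simplical_face_def standard_simplex_def Int_insert_left)
  finally show "simplex_map n (coface n k) t j = simplical_face k t j" .
qed

text \<open>\<open>singular_face\<close> is indexed by the degree of its source and
  \<open>face_map\<close> by that of its target, hence \<open>Suc n\<close> against
  \<open>n\<close>.\<close>

lemma face_map_CSing_MaxCtl: "face_map (CSing_MaxCtl X) n k \<sigma> = singular_face (Suc n) k \<sigma>"
  by (auto simp: face_map_def CSing_MaxCtl_def singular_face_def simplex_map_coface restrict_def)

lemma points_CSing_MaxCtl: "points (level (CSing_MaxCtl X) n) = singular_simplex_set n X"
  by (simp add: CSing_MaxCtl_def)

lemma support_subset: "support G S c \<subseteq> S"
  by (auto simp: support_def)

lemma formal_sums_CSing_MaxCtl: "formal_sums G (level (CSing_MaxCtl X) n) = BM_chain_group G X n"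
  by (simp add: formal_sums_def BM_chain_group_def CSing_MaxCtl_def support_subset)

lemma simp_boundary_CSing_MaxCtl:
  assumes G: "comm_group G" and c: "c \<in> carrier (BM_chain_group G X (Suc n))"
  shows "simp_boundary G (CSing_MaxCtl X) n c = BM_boundary G X n c"
proof (rule extensionalityI)
  note boundary = simp_boundary_closed_apply[OF G simplicial_controlled_set_CSing_MaxCtl
      c[folded formal_sums_CSing_MaxCtl]]
  \<comment> \<open>Closedness is used here: elements of the carrier are extensional, so comparing
    coefficients at singular simplices suffices.\<close>
  show "simp_boundary G (CSing_MaxCtl X) n c \<in> extensional (singular_simplex_set n X)"
    using boundary(1) by (auto simp: carrier_formal_sums points_CSing_MaxCtl PiE_def)
  show "BM_boundary G X n c \<in> extensional (singular_simplex_set n X)"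
    by (simp add: BM_boundary_def)
  show "simp_boundary G (CSing_MaxCtl X) n c \<tau> = BM_boundary G X n c \<tau>"
    if "\<tau> \<in> singular_simplex_set n X" for \<tau>
    using boundary(2)[unfolded points_CSing_MaxCtl face_map_CSing_MaxCtl, OF that] that
    by (simp add: BM_boundary_def)
qed

lemma boundaries_cong:
  assumes "\<And>c. c \<in> carrier (C (Suc n)) \<Longrightarrow> d n c = d' n c"
  shows "boundaries C d n = boundaries C d' n"
  using assms by (simp add: boundaries_def)

text \<open>Agreement is assumed in every degree because cycles in degree \<open>Suc k\<close>
  depend on \<open>d k\<close>, while those in degree 0 involve no differential.\<close>

lemma cycles_cong:
  assumes "\<And>n c. c \<in> carrier (C (Suc n)) \<Longrightarrow> d n c = d' n c"
  shows "cycles C d n = cycles C d' n"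
  using assms by (auto simp: cycles_def kernel_def split: nat.split)

theorem proposition5p1:
  fixes G :: "('g, 'm) monoid_scheme" and X :: "'a topology"
  assumes "comm_group G"
    and "locally_compact_space X" and "Hausdorff_space X"
  shows "\<forall>n. \<exists>h \<in> iso (simp_homology G (CSing_MaxCtl X) n) (BM_homology G X n).
           \<forall>z \<in> simp_cycles G (CSing_MaxCtl X) n.
             h (simp_homology_class G (CSing_MaxCtl X) n z) = BM_homology_class G X n z"
proof
  fix n
  note d = simp_boundary_CSing_MaxCtl[OF assms(1)]
  have "boundaries (BM_chain_group G X) (simp_boundary G (CSing_MaxCtl X)) n =
      boundaries (BM_chain_group G X) (BM_boundary G X) n"
    by (rule boundaries_cong) (rule d)
  moreover have "cycles (BM_chain_group G X) (simp_boundary G (CSing_MaxCtl X)) n =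
      cycles (BM_chain_group G X) (BM_boundary G X) n"
    by (rule cycles_cong) (rule d)
  ultimately have "simp_homology G (CSing_MaxCtl X) n = BM_homology G X n"
    and "simp_homology_class G (CSing_MaxCtl X) n z = BM_homology_class G X n z" for z
    by (simp_all only: homology_def homology_class_def formal_sums_CSing_MaxCtl)
  then show "\<exists>h \<in> iso (simp_homology G (CSing_MaxCtl X) n) (BM_homology G X n).
           \<forall>z \<in> simp_cycles G (CSing_MaxCtl X) n.
             h (simp_homology_class G (CSing_MaxCtl X) n z) = BM_homology_class G X n z"
    \<comment> \<open>The identity serves as \<open>h\<close>: both quotient groups are built from
      the same cycles and boundaries, so they and their classes are equal and not merely
      isomorphic.\<close>
    by (intro bexI[of _ "\<lambda>x. x"] ballI) (auto simp: iso_def hom_def bij_betw_def)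
qed

end
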